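(* Let $L=\{v\geq 3 : v\equiv 0,1 \pmod 3\}$ and $K^*_{\mathsf{DTS}}=\{v\geq 3 : \text{there exists a DTS}(v)\text{ having no } v\text{-good sequencing}\}$. Suppose $(X,\mathcal{B})$ is a $(v,L)$-PBD and there exists a block $B_0\in\mathcal{B}$ with $|B_0|\in K^*_{\mathsf{DTS}}$. Then $v\in K^*_{\mathsf{DTS}}$.
   Context: A transitive triple is an ordered triple $(x,y,z)$ of distinct elements; it contains the directed edges $(x,y)$, $(x,z)$, $(y,z)$. A directed triple system of order $v$, DTS$(v)$, is a pair $(X,\mathcal{B})$ where $X$ is a set of $v$ points and $\mathcal{B}$ is a set of transitive triples of elements of $X$ such that every ordered pair $(a,b)$ of distinct points of $X$ occurs as a directed edge in exactly one triple of $\mathcal{B}$. A $v$-good sequencing of a DTS$(v)$ $(X,\mathcal{B})$ is a permutation $[x_1\, x_2\, \cdots\, x_v]$ of $X$ such that for no triple $(x,y,z)\in\mathcal{B}$ do we have $x=x_i$, $y=x_j$, $z=x_k$ with $i<j<k$. For a set $K$ of integers $\geq 2$, a $(v,K)$-PBD is a pair $(X,\mathcal{B})$ with $|X|=v$ and $\mathcal{B}$ a set of subsets (blocks) of $X$ such that every pair of distinct points lies in exactly one block and $|B|\in K$ for every $B\in\mathcal{B}$. *)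

theory Defs
  imports Main "HOL-Combinatorics.Multiset_Permutations"
begin

definition transitive_triple :: "'a \<times> 'a \<times> 'a \<Rightarrow> bool" where
  "transitive_triple = (\<lambda>(x, y, z). x \<noteq> y \<and> x \<noteq> z \<and> y \<noteq> z)"

definition directed_edges :: "'a \<times> 'a \<times> 'a \<Rightarrow> ('a \<times> 'a) set" where
  "directed_edges = (\<lambda>(x, y, z). {(x, y), (x, z), (y, z)})"

definition is_DTS :: "nat \<Rightarrow> 'a set \<Rightarrow> ('a \<times> 'a \<times> 'a) set \<Rightarrow> bool" where
  "is_DTS v X \<B> \<longleftrightarrow>
     finite X \<and> card X = v \<and>
     \<B> \<subseteq> X \<times> X \<times> X \<and> (\<forall>T\<in>\<B>. transitive_triple T) \<and>
     (\<forall>a\<in>X. \<forall>b\<in>X. a \<noteq> b \<longrightarrow> (\<exists>!T. T \<in> \<B> \<and> (a, b) \<in> directed_edges T))"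

(* The sequencing [x_1 ... x_v] is the list xs, with x_i = xs ! (i - 1). *)
definition good_sequencing :: "'a set \<Rightarrow> ('a \<times> 'a \<times> 'a) set \<Rightarrow> 'a list \<Rightarrow> bool" where
  "good_sequencing X \<B> xs \<longleftrightarrow>
     xs \<in> permutations_of_set X \<and>
     \<not> (\<exists>i j k. i < j \<and> j < k \<and> k < length xs \<and> (xs ! i, xs ! j, xs ! k) \<in> \<B>)"

definition is_PBD :: "nat \<Rightarrow> nat set \<Rightarrow> 'a set \<Rightarrow> 'a set set \<Rightarrow> bool" where
  "is_PBD v K X \<B> \<longleftrightarrow>
     finite X \<and> card X = v \<and>
     (\<forall>B\<in>\<B>. B \<subseteq> X \<and> card B \<in> K) \<and>
     (\<forall>x\<in>X. \<forall>y\<in>X. x \<noteq> y \<longrightarrow> (\<exists>!B. B \<in> \<B> \<and> x \<in> B \<and> y \<in> B))"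

definition L_DTS :: "nat set" where
  "L_DTS = {v. v \<ge> 3 \<and> v mod 3 \<in> {0, 1}}"

(* Points may be taken to be natural numbers: point sets are finite, and being a DTS and
   having a good sequencing are preserved by relabelling the points. *)
definition K_star_DTS :: "nat set" where
  "K_star_DTS = {v. v \<ge> 3 \<and>
     (\<exists>(X :: nat set) \<B>. is_DTS v X \<B> \<and> \<not> (\<exists>xs. good_sequencing X \<B> xs))}"

end

theory Submission
  imports Defs "HOL-Library.Sublist"
begin

text \<open>Fill each block of the PBD with a directed triple system, using on \<open>B\<^sub>0\<close> one that has no good
  sequencing. The union is a directed triple system on \<open>X\<close>, and deleting the points outside \<open>B\<^sub>0\<close>
  from a good sequencing of it would leave a good sequencing of the system on \<open>B\<^sub>0\<close>. The other
  blocks need a directed triple system of every order \<open>v \<ge> 3\<close> with \<open>v \<equiv> 0, 1 (mod 3)\<close>: for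
  \<open>v = 3 n\<close> and \<open>v = 3 n + 1\<close> it comes from an idempotent quasigroup of order \<open>n\<close>, which
  exists unless \<open>n = 2\<close>, and orders 6 and 7 are done by hand.\<close>

section \<open>Relabelling and gluing\<close>

abbreviation map_triple :: "('a \<Rightarrow> 'b) \<Rightarrow> 'a \<times> 'a \<times> 'a \<Rightarrow> 'b \<times> 'b \<times> 'b" where
  "map_triple f \<equiv> map_prod f (map_prod f f)"

text \<open>Used both to carry the system without good sequencing onto a block and to bring the
  final system back to the natural numbers.\<close>

lemma is_DTS_image:
  assumes D: "is_DTS v X \<B>" and f: "inj_on f X"
  shows "is_DTS v (f ` X) (map_triple f ` \<B>)"
proof -
  have sub: "\<B> \<subseteq> X \<times> X \<times> X" and tt: "\<forall>T\<in>\<B>. transitive_triple T"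
    and ex: "\<And>a b. a \<in> X \<Longrightarrow> b \<in> X \<Longrightarrow> a \<noteq> b \<Longrightarrow> \<exists>!T. T \<in> \<B> \<and> (a, b) \<in> directed_edges T"
    using D unfolding is_DTS_def by auto
  have edges: "(f a, f b) \<in> directed_edges (map_triple f T) \<longleftrightarrow> (a, b) \<in> directed_edges T"
    if "T \<in> \<B>" "a \<in> X" "b \<in> X" for a b T
  proof -
    obtain x y z where T: "T = (x, y, z)" "x \<in> X" "y \<in> X" "z \<in> X"
      using \<open>\<B> \<subseteq> X \<times> X \<times> X\<close> \<open>T \<in> \<B>\<close> by auto
    show ?thesis
      using T that by (simp add: directed_edges_def inj_on_eq_iff[OF f])
  qed
  have cover: "\<exists>!T. T \<in> map_triple f ` \<B> \<and> (f a, f b) \<in> directed_edges T"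
    if ab: "a \<in> X" "b \<in> X" "a \<noteq> b" for a b
  proof -
    from ex[OF ab] obtain T where T: "T \<in> \<B>" "(a, b) \<in> directed_edges T"
      and uniq: "\<And>T'. T' \<in> \<B> \<Longrightarrow> (a, b) \<in> directed_edges T' \<Longrightarrow> T' = T"
      by blast
    show ?thesis
    proof (rule ex1I)
      show "map_triple f T \<in> map_triple f ` \<B> \<and> (f a, f b) \<in> directed_edges (map_triple f T)"
        using edges[OF T(1) ab(1,2)] T by blast
    next
      fix T' assume T': "T' \<in> map_triple f ` \<B> \<and> (f a, f b) \<in> directed_edges T'"
      from conjunct1[OF T'] obtain S where S: "T' = map_triple f S" "S \<in> \<B>"
        by (rule imageE)
      have "(a, b) \<in> directed_edges S"
        using T' edges[OF S(2) ab(1,2)] unfolding S(1) by simp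
      then show "T' = map_triple f T"
        using uniq[OF S(2)] S(1) by simp
    qed
  qed
  show ?thesis
    unfolding is_DTS_def
  proof (intro conjI ballI impI)
    show "finite (f ` X)" "card (f ` X) = v"
      using D f by (auto simp: is_DTS_def card_image)
    show "map_triple f ` \<B> \<subseteq> f ` X \<times> f ` X \<times> f ` X"
      using sub by auto
  next
    fix T assume "T \<in> map_triple f ` \<B>"
    then obtain x y z where xyz: "(x, y, z) \<in> \<B>" "T = map_triple f (x, y, z)"
      by auto
    then have "x \<in> X" "y \<in> X" "z \<in> X" "transitive_triple (x, y, z)"
      using sub tt by auto
    then show "transitive_triple T"
      by (simp add: xyz(2) transitive_triple_def inj_on_eq_iff[OF f])
  next
    fix a' b' assume "a' \<in> f ` X" "b' \<in> f ` X" "a' \<noteq> b'"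
    then obtain a b where "a' = f a" "b' = f b" "a \<in> X" "b \<in> X" "a \<noteq> b"
      by blast
    then show "\<exists>!T. T \<in> map_triple f ` \<B> \<and> (a', b') \<in> directed_edges T"
      using cover by simp
  qed
qed

text \<open>Existence depends only on the order, so each system may be built on whichever point set
  is convenient.\<close>

lemma DTS_transfer:
  fixes X :: "'a set" and Y :: "'b set"
  assumes "is_DTS v X \<B>" "finite Y" "card Y = v"
  shows "\<exists>\<C>. is_DTS v Y \<C>"
proof -
  have "finite X" "card X = card Y"
    using assms by (auto simp: is_DTS_def)
  then obtain f where "bij_betw f X Y"
    using finite_same_card_bij \<open>finite Y\<close> by metis
  then show ?thesis
    using is_DTS_image[OF assms(1), of f] by (auto simp: bij_betw_def)
qed

text \<open>All edges of a triple of \<open>D G\<close> stay inside \<open>G\<close>. Hence a pair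
  in exactly one set of the family is covered once, by that set's system, and a pair in none is left
  to \<T>. This serves the PBD (with \<T> empty) as well as Bose's construction.\<close>

lemma DTS_decomposition:
  assumes X: "finite X" "card X = v"
    and G: "\<And>G. G \<in> \<G> \<Longrightarrow> G \<subseteq> X \<and> is_DTS (card G) G (D G)"
    and T: "\<T> \<subseteq> X \<times> X \<times> X" "\<And>T. T \<in> \<T> \<Longrightarrow> transitive_triple T"
    and pairs: "\<And>a b. a \<in> X \<Longrightarrow> b \<in> X \<Longrightarrow> a \<noteq> b \<Longrightarrow>
      (\<exists>!G. G \<in> \<G> \<and> a \<in> G \<and> b \<in> G) \<and> (\<nexists>T. T \<in> \<T> \<and> (a, b) \<in> directed_edges T) \<or>
      (\<nexists>G. G \<in> \<G> \<and> a \<in> G \<and> b \<in> G) \<and> (\<exists>!T. T \<in> \<T> \<and> (a, b) \<in> directed_edges T)"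
  shows "is_DTS v X (\<T> \<union> (\<Union>G\<in>\<G>. D G))"
proof -
  have sub: "D G \<subseteq> G \<times> G \<times> G" and tt: "\<And>T. T \<in> D G \<Longrightarrow> transitive_triple T"
    and ex: "\<And>a b. a \<in> G \<Longrightarrow> b \<in> G \<Longrightarrow> a \<noteq> b \<Longrightarrow> \<exists>!T. T \<in> D G \<and> (a, b) \<in> directed_edges T"
    if "G \<in> \<G>" for G
    using G[OF that] unfolding is_DTS_def by auto
  have mem: "a \<in> G" "b \<in> G" if "G \<in> \<G>" "T \<in> D G" "(a, b) \<in> directed_edges T" for a b T G
    using sub[OF that(1)] that(2,3) by (auto simp: directed_edges_def)
  have cover: "\<exists>!T. T \<in> \<T> \<union> (\<Union>G\<in>\<G>. D G) \<and> (a, b) \<in> directed_edges T"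
    if ab: "a \<in> X" "b \<in> X" "a \<noteq> b" for a b
    using pairs[OF ab]
  proof (elim disjE conjE)
    assume "\<exists>!G. G \<in> \<G> \<and> a \<in> G \<and> b \<in> G"
      and none: "\<nexists>T. T \<in> \<T> \<and> (a, b) \<in> directed_edges T"
    then obtain G where H: "G \<in> \<G>" "a \<in> G" "b \<in> G"
      and uniq: "\<And>H. H \<in> \<G> \<Longrightarrow> a \<in> H \<Longrightarrow> b \<in> H \<Longrightarrow> H = G"
      by blast
    from ex[OF H ab(3)] obtain T where T: "T \<in> D G" "(a, b) \<in> directed_edges T"
      and uniqT: "\<And>T'. T' \<in> D G \<Longrightarrow> (a, b) \<in> directed_edges T' \<Longrightarrow> T' = T"
      by blast
    show ?thesis
    proof (rule ex1I[of _ T])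
      show "T \<in> \<T> \<union> (\<Union>G\<in>\<G>. D G) \<and> (a, b) \<in> directed_edges T"
        using T H by blast
    next
      fix T' assume "T' \<in> \<T> \<union> (\<Union>G\<in>\<G>. D G) \<and> (a, b) \<in> directed_edges T'"
      then obtain H where "H \<in> \<G>" "T' \<in> D H" "(a, b) \<in> directed_edges T'"
        using none by blast
      then show "T' = T"
        using uniq uniqT mem by metis
    qed
  next
    assume none: "\<nexists>G. G \<in> \<G> \<and> a \<in> G \<and> b \<in> G"
      and ex1: "\<exists>!T. T \<in> \<T> \<and> (a, b) \<in> directed_edges T"
    have "T \<in> \<T> \<union> (\<Union>G\<in>\<G>. D G) \<and> (a, b) \<in> directed_edges T \<longleftrightarrow>
          T \<in> \<T> \<and> (a, b) \<in> directed_edges T" for T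
      using none mem by blast
    then show ?thesis
      using ex1 by simp
  qed
  have within: "\<T> \<union> (\<Union>G\<in>\<G>. D G) \<subseteq> X \<times> X \<times> X"
    using T(1) sub G by blast
  have trans: "\<forall>T\<in>\<T> \<union> (\<Union>G\<in>\<G>. D G). transitive_triple T"
    using T(2) tt by blast
  show ?thesis
    unfolding is_DTS_def by (intro conjI ballI impI X within bspec[OF trans] cover)
qed

section \<open>Idempotent quasigroups\<close>

text \<open>An idempotent Latin square: on a finite carrier, injective rows and columns are
  permutations.\<close>

definition idem_quasigroup :: "'q set \<Rightarrow> ('q \<Rightarrow> 'q \<Rightarrow> 'q) \<Rightarrow> bool" where
  "idem_quasigroup Q f \<longleftrightarrow>
     finite Q \<and> (\<forall>x\<in>Q. \<forall>y\<in>Q. f x y \<in> Q) \<and> (\<forall>x\<in>Q. f x x = x) \<and>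
     (\<forall>x\<in>Q. inj_on (f x) Q) \<and> (\<forall>y\<in>Q. inj_on (\<lambda>x. f x y) Q)"

lemma eq_if_dvd_diff_int:
  fixes x y m :: int
  assumes "m dvd x - y" "x \<in> {0..<m}" "y \<in> {0..<m}"
  shows "x = y"
  using assms by (metis atLeastLessThan_iff mod_eq_dvd_iff mod_pos_pos_trivial)

lemma odd_dvd_double_int:
  fixes m x :: int
  assumes "odd m" "m dvd 2 * x"
  shows "m dvd x"
proof -
  have "coprime m 2"
    using assms(1) by simp
  then show ?thesis
    using assms(2) coprime_dvd_mult_right_iff by blast
qed

text \<open>Rows are injective because \<open>y\<close> occurs with coefficient -1, columns because
  2 is invertible modulo an odd \<open>m\<close>.\<close>

lemma idem_quasigroup_odd:
  fixes m :: int
  assumes m: "odd m" "m > 0"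
  shows "idem_quasigroup {0..<m} (\<lambda>x y. (2 * x - y) mod m)"
proof -
  have left: "y = y'" if "x \<in> {0..<m}" "y \<in> {0..<m}" "y' \<in> {0..<m}"
    and e: "(2 * x - y) mod m = (2 * x - y') mod m" for x y y'
  proof -
    have "m dvd (2 * x - y) - (2 * x - y')"
      using e by (simp only: mod_eq_dvd_iff)
    then have "m dvd y' - y"
      by simp
    with that show ?thesis
      using eq_if_dvd_diff_int[of m y' y] by simp
  qed
  have right: "x = x'" if "y \<in> {0..<m}" "x \<in> {0..<m}" "x' \<in> {0..<m}"
    and e: "(2 * x - y) mod m = (2 * x' - y) mod m" for x x' y
  proof -
    have "m dvd (2 * x - y) - (2 * x' - y)"
      using e by (simp only: mod_eq_dvd_iff)
    then have "m dvd 2 * (x - x')"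
      by (simp add: algebra_simps)
    then have "m dvd x - x'"
      by (rule odd_dvd_double_int[OF m(1)])
    with that show ?thesis
      using eq_if_dvd_diff_int[of m x x'] by simp
  qed
  show ?thesis
    unfolding idem_quasigroup_def
  proof (intro conjI ballI inj_onI)
    show "(2 * x - x) mod m = x" if "x \<in> {0..<m}" for x
      using that by simp
  qed (use m in simp, use m in simp, (erule (3) left right)+)
qed

text \<open>The cells \<open>(x, x + 1)\<close> form a transversal of the table of \<open>2 x - y\<close> that avoids the
  diagonal; prolonging the table along it adds one idempotent element.\<close>

fun prolonged :: "int \<Rightarrow> int option \<Rightarrow> int option \<Rightarrow> int option" where
  "prolonged m (Some x) (Some y) =
     (if y = (x + 1) mod m then None else Some ((2 * x - y) mod m))"
| "prolonged m (Some x) None = Some ((x - 1) mod m)"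
| "prolonged m None (Some y) = Some ((y - 2) mod m)"
| "prolonged m None None = None"

text \<open>The entry displaced by \<open>None\<close> is 2x - (x + 1) = x - 1 in row
  \<open>x\<close> and 2(y - 1) - y = y - 2 in column \<open>y\<close>. Moving these into the new
  column and the new row keeps every line a permutation.\<close>

lemma idem_quasigroup_prolonged:
  fixes m :: int
  assumes m: "odd m" "m > 1"
  shows "idem_quasigroup (insert None (Some ` {0..<m})) (prolonged m)"
proof -
  let ?Z = "{0..<m}"
  have cancel: "a = b" if "m dvd a - b" "a \<in> ?Z" "b \<in> ?Z" for a b
    using that by (rule eq_if_dvd_diff_int)
  have succ: "y = (x + 1) mod m \<longleftrightarrow> m dvd x + 1 - y" if "y \<in> ?Z" for x y
    using that by (metis atLeastLessThan_iff mod_eq_dvd_iff mod_pos_pos_trivial)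
  note half = odd_dvd_double_int[OF m(1)]
  \<comment> \<open>Otherwise \<open>m\<close> would divide 1. Hence no diagonal entry is displaced
    and idempotence survives.\<close>
  have ne: "x \<noteq> (x + 1) mod m" if "x \<in> ?Z" for x
    using succ[OF that, of x] m by (auto dest: zdvd_imp_le)
  text \<open>Each clash between two entries of a row or column is a divisibility by \<open>m\<close>; the next four
    facts are stated in the form into which the simplifier brings these.\<close>
  have row: "m dvd x + 1 - y" if "m dvd y - x - 1" for x y
    using that by (subst dvd_diff_commute) (simp add: algebra_simps)
  have col: "m dvd x + 1 - y" if "m dvd 2 * x + 2 - 2 * y" for x y
    using half[of "x + 1 - y"] that by (simp add: algebra_simps)
  have col': "m dvd x + 1 - y" if "m dvd 2 * y - 2 - 2 * x" for x y
    using half[of "y - 1 - x"] that dvd_diff_commute[of m y "x + 1"] by (simp add: algebra_simps)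
  have col'': "x = x'" if "m dvd 2 * x - 2 * x'" "x \<in> ?Z" "x' \<in> ?Z" for x x'
    using half[of "x - x'"] cancel[of x x'] that by (simp add: algebra_simps)
  have left: "inj_on (prolonged m p) (insert None (Some ` ?Z))" if "p \<in> insert None (Some ` ?Z)" for p
  proof (rule inj_onI)
    fix q r assume q: "q \<in> insert None (Some ` ?Z)" and r: "r \<in> insert None (Some ` ?Z)"
      and e: "prolonged m p q = prolonged m p r"
    show "q = r"
      using that q r e
      by (cases p; cases q; cases r)
         (auto split: if_splits simp: mod_eq_dvd_iff succ add_diff_eq simp del: atLeastLessThan_iff
           dest: cancel row)
  qed
  have right: "inj_on (\<lambda>p. prolonged m p q) (insert None (Some ` ?Z))" if "q \<in> insert None (Some ` ?Z)" for q
  proof (rule inj_onI)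
    fix p r assume p: "p \<in> insert None (Some ` ?Z)" and r: "r \<in> insert None (Some ` ?Z)"
      and e: "prolonged m p q = prolonged m r q"
    show "p = r"
      using that p r e
      by (cases p; cases q; cases r)
         (auto split: if_splits simp: mod_eq_dvd_iff succ add_diff_eq simp del: atLeastLessThan_iff
           dest: cancel col col' col'')
  qed
  have closed: "prolonged m p q \<in> insert None (Some ` ?Z)" for p q
    using m by (cases p; cases q) auto
  have idem: "prolonged m p p = p" if "p \<in> insert None (Some ` ?Z)" for p
    using that ne by (cases p) auto
  show ?thesis
    unfolding idem_quasigroup_def by (intro conjI ballI closed idem left right) simp
qed

text \<open>Puts the odd orders on the type \<open>int option\<close> of the prolonged ones, so that
  one existence statement covers both.\<close>

lemma idem_quasigroup_Some:
  assumes "idem_quasigroup Q f"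
  shows "idem_quasigroup (Some ` Q) (\<lambda>p q. Some (f (the p) (the q)))"
proof -
  have Q: "finite Q" "\<And>x y. x \<in> Q \<Longrightarrow> y \<in> Q \<Longrightarrow> f x y \<in> Q" "\<And>x. x \<in> Q \<Longrightarrow> f x x = x"
    and inj: "\<And>x. x \<in> Q \<Longrightarrow> inj_on (f x) Q" "\<And>y. y \<in> Q \<Longrightarrow> inj_on (\<lambda>x. f x y) Q"
    using assms by (simp_all add: idem_quasigroup_def)
  have lift: "inj_on (\<lambda>q. Some (g (the q))) (Some ` Q)" if "inj_on g Q" for g :: "'a \<Rightarrow> 'a"
    using that by (simp add: inj_on_def)
  show ?thesis
    unfolding idem_quasigroup_def ball_simps option.sel
    using Q lift[OF inj(1)] lift[OF inj(2)] by simp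
qed

lemma idem_quasigroup_exists:
  assumes "n > 0" "n \<noteq> 2"
  shows "\<exists>(Q :: int option set) f. idem_quasigroup Q f \<and> card Q = n"
proof (cases "odd n")
  case True
  then have "odd (int n)" "int n > 0"
    using assms by simp_all
  note idem_quasigroup_Some[OF idem_quasigroup_odd[OF this]]
  moreover have "card (Some ` {0..<int n}) = n"
    by (simp add: card_image)
  ultimately show ?thesis
    by (intro exI conjI)
next
  case False
  \<comment> \<open>An even order is reached by prolonging the odd order \<open>n - 1\<close>, which
    is at least 3.\<close>
  then have "n \<ge> 4"
    using assms by presburger
  then have "odd (int n - 1)" "int n - 1 > 1"
    using False by simp_all
  note idem_quasigroup_prolonged[OF this]
  moreover have "card (insert None (Some ` {0..<int n - 1})) = n"
    using \<open>n \<ge> 4\<close> by (subst card_insert_disjoint) (auto simp: card_image)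
  ultimately show ?thesis
    by (intro exI conjI)
qed

section \<open>Existence of directed triple systems\<close>

text \<open>Both hypotheses are executable. Counting list entries replaces unique existence, and the
  edge condition is spelled out as equality tests.\<close>

lemma DTS_of_list:
  fixes ts :: "(nat \<times> nat \<times> nat) list"
  assumes triples: "\<forall>(x, y, z)\<in>set ts. x < v \<and> y < v \<and> z < v \<and> x \<noteq> y \<and> x \<noteq> z \<and> y \<noteq> z"
    and pairs: "list_all (\<lambda>a. list_all (\<lambda>b. a \<noteq> b \<longrightarrow>
      length (filter (\<lambda>(x, y, z). a = x \<and> (b = y \<or> b = z) \<or> a = y \<and> b = z) ts) = 1)
      [0..<v]) [0..<v]"
  shows "is_DTS v {..<v} (set ts)"
proof -
  have "\<exists>!T. T \<in> set ts \<and> (a, b) \<in> directed_edges T" if "a < v" "b < v" "a \<noteq> b" for a b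
  proof -
    have "length (filter (\<lambda>T. (a, b) \<in> directed_edges T) ts) =
        length (filter (\<lambda>(x, y, z). a = x \<and> (b = y \<or> b = z) \<or> a = y \<and> b = z) ts)"
      by (intro arg_cong[where f = length] filter_cong) (auto simp: directed_edges_def)
    also have "\<dots> = 1"
      using pairs that by (simp add: list_all_iff)
    finally obtain T where "filter (\<lambda>T. (a, b) \<in> directed_edges T) ts = [T]"
      by (metis One_nat_def length_0_conv length_Suc_conv)
    then have "set (filter (\<lambda>T. (a, b) \<in> directed_edges T) ts) = {T}"
      by simp
    then have "T' \<in> set ts \<and> (a, b) \<in> directed_edges T' \<longleftrightarrow> T' \<in> {T}" for T'
      by (metis (no_types, lifting) mem_Collect_eq set_filter)
    then show ?thesis
      by (intro ex1I[of _ T]) auto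
  qed
  moreover have "set ts \<subseteq> {..<v} \<times> {..<v} \<times> {..<v}" "\<forall>T\<in>set ts. transitive_triple T"
    using triples unfolding transitive_triple_def by auto
  ultimately show ?thesis
    unfolding is_DTS_def by simp
qed

section \<open>The small orders 3, 4, 6 and 7\<close>

lemma DTS_3: "\<exists>\<B>. is_DTS 3 {..<3 :: nat} \<B>"
  by (rule exI, rule DTS_of_list[of "[(0, 1, 2), (2, 1, 0)]"]) code_simp+

lemma DTS_4: "\<exists>\<B>. is_DTS 4 {..<4 :: nat} \<B>"
  by (rule exI, rule DTS_of_list[of "[(0, 1, 2), (1, 0, 3), (2, 3, 0), (3, 2, 1)]"]) code_simp+

lemma DTS_6: "\<exists>\<B>. is_DTS 6 {..<6 :: nat} \<B>"
  by (rule exI, rule DTS_of_list[of "[(0, 1, 2), (0, 3, 4), (1, 0, 5), (1, 4, 3), (2, 3, 0),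
      (2, 4, 1), (3, 2, 5), (5, 3, 1), (4, 5, 0), (5, 4, 2)]"]) code_simp+

text \<open>Each line of the Fano plane in both directions.\<close>

lemma DTS_7: "\<exists>\<B>. is_DTS 7 {..<7 :: nat} \<B>"
  by (rule exI, rule DTS_of_list[of
      "[(0, 1, 3), (1, 2, 4), (2, 3, 5), (3, 4, 6), (4, 5, 0), (5, 6, 1), (6, 0, 2),
        (3, 1, 0), (4, 2, 1), (5, 3, 2), (6, 4, 3), (0, 5, 4), (1, 6, 5), (2, 0, 6)]"]) code_simp+

section \<open>Division in a finite quasigroup and Bose's construction\<close>

lemma inj_endo_Ex1:
  assumes "finite Q" "g ` Q \<subseteq> Q" "inj_on g Q" "z \<in> Q"
  shows "\<exists>!y. y \<in> Q \<and> g y = z"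
proof -
  have "z \<in> g ` Q"
    using endo_inj_surj[OF assms(1-3)] assms(4) by simp
  then obtain y where "y \<in> Q" "z = g y"
    by (rule imageE)
  then show ?thesis
    using inj_onD[OF assms(3)] by metis
qed

lemma idem_quasigroup_divide:
  assumes "idem_quasigroup Q f" "x \<in> Q" "z \<in> Q"
  shows "\<exists>!y. y \<in> Q \<and> f x y = z" and "\<exists>!y. y \<in> Q \<and> f y x = z"
  using assms inj_endo_Ex1[of Q "f x" z] inj_endo_Ex1[of Q "\<lambda>y. f y x" z]
  by (simp_all add: idem_quasigroup_def image_subset_iff)

text \<open>Carries the uniqueness of a quotient over to the triple that is built from it.\<close>

lemma Ex1_image:
  assumes "\<exists>!x. P x"
  shows "\<exists>!y. \<exists>x. P x \<and> y = g x"
proof -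
  obtain x where "P x" "\<And>x'. P x' \<Longrightarrow> x' = x"
    using assms by blast
  then show ?thesis
    by (intro ex1I[of _ "g x"]) metis+
qed

text \<open>Bose's construction with directed triples. Putting the point of the next level into the
  middle makes an edge between level \<open>i\<close> and level \<open>i + 1\<close> an upward edge at the head of a triple
  or a downward edge at its tail, so each arises from exactly one division in the quasigroup; hence
  commutativity is not needed. The pairs over a single element of the quasigroup, and
  those with the optional extra point \<open>None\<close>, are left to systems of order 3 or 4.\<close>

lemma DTS_of_idem_quasigroup:
  fixes Q :: "'q set" and W :: "('q \<times> nat) option set"
  assumes Q: "idem_quasigroup Q f" and W: "W \<subseteq> {None}"
    and base: "\<And>Y :: ('q \<times> nat) option set. finite Y \<Longrightarrow> card Y = 3 + card W \<Longrightarrow>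
      \<exists>\<B>. is_DTS (card Y) Y \<B>"
  shows "\<exists>\<B>. is_DTS (3 * card Q + card W) (Some ` (Q \<times> {..<3}) \<union> W) \<B>"
proof -
  define G where "G = (\<lambda>x. Some ` ({x} \<times> {..<3::nat}) \<union> W)"
  define t where "t = (\<lambda>x y i :: nat. (Some (x, i), Some (f x y, Suc i mod 3), Some (y, i)))"
  define \<T> where "\<T> = {t x y i | x y i. x \<in> Q \<and> y \<in> Q \<and> x \<noteq> y \<and> i < 3}"
  \<comment> \<open>\<open>base\<close> yields only existence, so one system per point set is
    chosen.\<close>
  define D where "D H = (SOME \<B>. is_DTS (card H) H \<B>)" for H :: "('q \<times> nat) option set"
  have finW: "finite W"
    using W finite_subset by blast
  have fQ: "finite Q" "\<And>x y. x \<in> Q \<Longrightarrow> y \<in> Q \<Longrightarrow> f x y \<in> Q" "\<And>x. x \<in> Q \<Longrightarrow> f x x = x"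
    using Q by (auto simp: idem_quasigroup_def)
  note div = idem_quasigroup_divide[OF Q]
  \<comment> \<open>If \<open>f x y = x = f x x\<close>, cancellation gives \<open>y = x\<close>;
    likewise for columns. So the middle point of a triple lies over a third element.\<close>
  have ne: "f x y \<noteq> x" "f x y \<noteq> y" if "x \<in> Q" "y \<in> Q" "x \<noteq> y" for x y
    using div(1)[of x x] div(2)[of y y] fQ(3) that by metis+
  have card_Some: "card (Some ` (A \<times> {..<3::nat}) \<union> W) = 3 * card A + card W"
    if "finite A" for A :: "'q set"
  proof -
    have "card (Some ` (A \<times> {..<3::nat}) \<union> W) = card (Some ` (A \<times> {..<3::nat})) + card W"
      using that W finW by (intro card_Un_disjoint) auto
    then show ?thesis
      by (simp add: card_image card_cartesian_product)
  qed
  have "\<exists>\<B>. is_DTS (card (G x)) (G x) \<B>" for x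
    using card_Some[of "{x}"] finW by (intro base) (auto simp: G_def)
  then have D: "is_DTS (card (G x)) (G x) (D (G x))" for x
    unfolding D_def by (rule someI_ex)
  have memG: "Some (x, i) \<in> G q \<longleftrightarrow> q = x \<and> i < 3" "None \<in> G q \<longleftrightarrow> None \<in> W" for x i q
    using W by (auto simp: G_def)
  \<comment> \<open>The disjuncts are the edges first to last, first to middle and middle to last.
    The bracketing of the existentials matches \<open>Ex1_image\<close> applied to a
    division.\<close>
  have edge: "T \<in> \<T> \<and> (Some (x, i), Some (y, j)) \<in> directed_edges T \<longleftrightarrow>
      x \<noteq> y \<and> (i = j \<and> T = t x y i \<or>
        j = Suc i mod 3 \<and> (\<exists>z. (z \<in> Q \<and> f x z = y) \<and> T = t x z i) \<or>
        i = Suc j mod 3 \<and> (\<exists>z. (z \<in> Q \<and> f z y = x) \<and> T = t z y j))"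
    (is "?L \<longleftrightarrow> ?R")
    if xy: "x \<in> Q" "y \<in> Q" "i < 3" "j < 3" for T x y i j
  proof
    assume ?L
    then obtain p q k where T: "T = t p q k" "p \<in> Q" "q \<in> Q" "p \<noteq> q" "k < 3"
      by (auto simp: \<T>_def)
    with \<open>?L\<close> show ?R
      using ne[of p q] by (auto simp: t_def directed_edges_def)
  next
    assume ?R
    then show ?L
      using xy fQ(3) by (auto simp: \<T>_def t_def directed_edges_def)
  qed
  have memX: "Some (x, i) \<in> Some ` (Q \<times> {..<3}) \<union> W \<longleftrightarrow> x \<in> Q \<and> i < 3" for x i
    using W by auto
  have noNone: "a \<noteq> None \<and> b \<noteq> None" if "T \<in> \<T>" "(a, b) \<in> directed_edges T" for T a b
    using that by (auto simp: \<T>_def t_def directed_edges_def)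
  let ?X = "Some ` (Q \<times> {..<3}) \<union> W"
  have "is_DTS (3 * card Q + card W) ?X (\<T> \<union> (\<Union>H\<in>G ` Q. D H))"
  proof (rule DTS_decomposition)
    show "finite ?X" "card ?X = 3 * card Q + card W"
      using fQ(1) finW card_Some by auto
    show "H \<subseteq> ?X \<and> is_DTS (card H) H (D H)" if "H \<in> G ` Q" for H
      using that D by (auto simp: G_def)
    show "\<T> \<subseteq> ?X \<times> ?X \<times> ?X"
      using fQ(2) by (auto simp: \<T>_def t_def)
    fix T assume "T \<in> \<T>"
    then obtain x y i where "T = t x y i" "x \<in> Q" "y \<in> Q" "x \<noteq> y"
      by (auto simp: \<T>_def)
    then show "transitive_triple T"
      using ne[of x y] by (auto simp: t_def transitive_triple_def)
  next
    fix a b assume ab: "a \<in> ?X" "b \<in> ?X" "a \<noteq> b"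
    show "(\<exists>!H. H \<in> G ` Q \<and> a \<in> H \<and> b \<in> H) \<and> (\<nexists>T. T \<in> \<T> \<and> (a, b) \<in> directed_edges T) \<or>
      (\<nexists>H. H \<in> G ` Q \<and> a \<in> H \<and> b \<in> H) \<and> (\<exists>!T. T \<in> \<T> \<and> (a, b) \<in> directed_edges T)"
    \<comment> \<open>Pairs over distinct elements of \<open>Q\<close> belong to the triples in
      \<T>; all others lie in exactly one set \<open>G x\<close>.\<close>
    proof (cases "\<exists>x i y j. a = Some (x, i) \<and> b = Some (y, j) \<and> x \<noteq> y")
      case True
      then obtain x i y j where *: "a = Some (x, i)" "b = Some (y, j)" "x \<noteq> y"
        by blast
      have "x \<in> Q \<and> i < 3" "y \<in> Q \<and> j < 3"
        using ab(1,2) unfolding *(1,2) memX .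
      then have xy: "x \<in> Q" "y \<in> Q" "i < 3" "j < 3"
        by blast+
      have ij: "i \<in> {0, 1, 2}" "j \<in> {0, 1, 2}"
        using xy(3,4) by auto
      \<comment> \<open>Two levels modulo 3 are equal or adjacent in exactly one direction, so only
        one disjunct of \<open>edge\<close> survives.\<close>
      have "i = j \<or> j = Suc i mod 3 \<or> i = Suc j mod 3"
        using ij by auto
      moreover have "Suc i mod 3 \<noteq> i" "Suc j mod 3 \<noteq> j" "Suc (Suc i mod 3) mod 3 \<noteq> i"
          "Suc (Suc j mod 3) mod 3 \<noteq> j"
        using ij by (auto simp flip: numeral_2_eq_2)
      ultimately consider "i = j" "j \<noteq> Suc i mod 3" "i \<noteq> Suc j mod 3"
        | "j = Suc i mod 3" "i \<noteq> j" "i \<noteq> Suc j mod 3"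
        | "i = Suc j mod 3" "i \<noteq> j" "j \<noteq> Suc i mod 3"
        by metis
      then have "\<exists>!T. T \<in> \<T> \<and> (a, b) \<in> directed_edges T"
      proof cases
        case 1
        show ?thesis
          unfolding *(1,2) edge[OF xy] using *(3) 1 by simp
      next
        case 2
        have "T \<in> \<T> \<and> (a, b) \<in> directed_edges T \<longleftrightarrow>
            (\<exists>z. (z \<in> Q \<and> f x z = y) \<and> T = t x z i)" for T
          unfolding *(1,2) edge[OF xy] by (simp add: *(3) 2(2,3) flip: 2(1))
        then show ?thesis
          using Ex1_image[OF div(1)[OF xy(1,2)], of "\<lambda>z. t x z i"] by (simp only:)
      next
        case 3
        have "T \<in> \<T> \<and> (a, b) \<in> directed_edges T \<longleftrightarrow>
            (\<exists>z. (z \<in> Q \<and> f z y = x) \<and> T = t z y j)" for T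
          unfolding *(1,2) edge[OF xy] by (simp add: *(3) 3(2,3) flip: 3(1))
        then show ?thesis
          using Ex1_image[OF div(2)[OF xy(2,1)], of "\<lambda>z. t z y j"] by (simp only:)
      qed
      then show ?thesis
        using * memG by auto
    next
      case False
      have none: "\<nexists>T. T \<in> \<T> \<and> (a, b) \<in> directed_edges T"
      proof
        assume "\<exists>T. T \<in> \<T> \<and> (a, b) \<in> directed_edges T"
        then obtain T where T: "T \<in> \<T>" "(a, b) \<in> directed_edges T"
          by blast
        then obtain x i y j where *: "a = Some (x, i)" "b = Some (y, j)"
          using noNone[OF T] by auto
        have "x \<in> Q \<and> i < 3" "y \<in> Q \<and> j < 3"
          using ab(1,2) unfolding *(1,2) memX .
        then have xy: "x \<in> Q" "y \<in> Q" "i < 3" "j < 3"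
          by blast+
        show False
          using edge[OF xy, of T] T False * by blast
      qed
      \<comment> \<open>At most one of the points is \<open>None\<close>, since they differ; the
        other point then determines \<open>x\<close>.\<close>
      have "\<exists>x\<in>Q. \<forall>q\<in>Q. a \<in> G q \<and> b \<in> G q \<longleftrightarrow> q = x"
        using ab False W by (cases a; cases b) (auto simp: memG)
      then obtain x where x: "x \<in> Q" "\<And>q. q \<in> Q \<Longrightarrow> a \<in> G q \<and> b \<in> G q \<longleftrightarrow> q = x"
        by blast
      have "\<exists>!H. H \<in> G ` Q \<and> a \<in> H \<and> b \<in> H"
      proof (rule ex1I)
        show "G x \<in> G ` Q \<and> a \<in> G x \<and> b \<in> G x"
          using x by simp
      next
        fix H assume "H \<in> G ` Q \<and> a \<in> H \<and> b \<in> H"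
        then show "H = G x"
          using x(2) by auto
      qed
      then show ?thesis
        using none by (rule disjI1[OF conjI])
    qed
  qed
  then show ?thesis
    by blast
qed

lemma DTS_exists:
  assumes "v \<in> L_DTS"
  shows "\<exists>\<B>. is_DTS v {..<v :: nat} \<B>"
proof -
  define n where "n = v div 3"
  define r where "r = v mod 3"
  have v: "v = 3 * n + r" and n: "n > 0" and r: "r = 0 \<or> r = 1"
    using assms by (auto simp: L_DTS_def n_def r_def)
  show ?thesis
  proof (cases "n = 2")
    case True
    then show ?thesis
      using v r DTS_6 DTS_7 by auto
  next
    case False
    then obtain Q :: "int option set" and f where Q: "idem_quasigroup Q f" "card Q = n"
      using idem_quasigroup_exists n by blast
    \<comment> \<open>The residue \<open>r\<close> decides whether the extra point is present; the
      base systems have order \<open>3 + r\<close>.\<close>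
    define W :: "(int option \<times> nat) option set" where "W = (if r = 0 then {} else {None})"
    have W: "W \<subseteq> {None}" "card W = r"
      using r by (auto simp: W_def)
    have "\<exists>\<B>. is_DTS (card Y) Y \<B>" if "finite Y" "card Y = 3 + card W"
      for Y :: "(int option \<times> nat) option set"
    proof -
      have "\<exists>\<B>. is_DTS (card Y) {..<card Y} \<B>"
        using r that(2) W(2) DTS_3 DTS_4 by auto
      then show ?thesis
        using DTS_transfer[OF _ that(1) refl] by blast
    qed
    then obtain \<B> where "is_DTS v (Some ` (Q \<times> {..<3}) \<union> W) \<B>"
      using DTS_of_idem_quasigroup[OF Q(1) W(1)] Q(2) W(2) v by auto
    then show ?thesis
      using DTS_transfer[of v _ \<B> "{..<v}"] by simp
  qed
qed

section \<open>Good sequencings\<close>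

lemma good_sequencingI:
  assumes "xs \<in> permutations_of_set X"
    and "\<And>i j k. i < j \<Longrightarrow> j < k \<Longrightarrow> k < length xs \<Longrightarrow> (xs ! i, xs ! j, xs ! k) \<notin> \<B>"
  shows "good_sequencing X \<B> xs"
  using assms unfolding good_sequencing_def by blast

lemma good_sequencingD:
  assumes "good_sequencing X \<B> xs" "i < j" "j < k" "k < length xs"
  shows "(xs ! i, xs ! j, xs ! k) \<notin> \<B>"
  using assms unfolding good_sequencing_def by blast

text \<open>Turns increasing positions in a sublist into increasing positions in the full
  list.\<close>

lemma subseq_imp_index_map:
  assumes "subseq ys xs"
  shows "\<exists>h. (\<forall>i < length ys. h i < length xs \<and> xs ! h i = ys ! i) \<and>
    (\<forall>i j. i < j \<longrightarrow> j < length ys \<longrightarrow> h i < (h j :: nat))"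
  using assms
proof (induction rule: list_emb.induct)
  case (list_emb_Nil xs)
  then show ?case
    by simp
next
  case (list_emb_Cons ys xs x)
  then obtain h where "\<forall>i < length ys. h i < length xs \<and> xs ! h i = ys ! i"
      "\<forall>i j. i < j \<longrightarrow> j < length ys \<longrightarrow> h i < h j"
    by blast
  then show ?case
    \<comment> \<open>The head of the longer list is skipped, which shifts every position by
      one.\<close>
    by (intro exI[of _ "Suc \<circ> h"]) auto
next
  case (list_emb_Cons2 y x ys xs)
  then obtain h where "\<forall>i < length ys. h i < length xs \<and> xs ! h i = ys ! i"
      "\<forall>i j. i < j \<longrightarrow> j < length ys \<longrightarrow> h i < h j"
    by blast
  then show ?case
    using \<open>y = x\<close>
    \<comment> \<open>The heads are matched at position 0; only the later positions are
      shifted.\<close>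
    by (intro exI[of _ "\<lambda>i. case i of 0 \<Rightarrow> 0 | Suc k \<Rightarrow> Suc (h k)"])
       (auto split: nat.splits simp: nth_Cons')
qed

text \<open>Filtering preserves order, so a triple of \<C> in increasing position would already be
  one of \<B> in \<open>xs\<close>.\<close>

lemma good_sequencing_restrict:
  assumes xs: "good_sequencing X \<B> xs" and "Y \<subseteq> X" "\<C> \<subseteq> \<B>"
  shows "good_sequencing Y \<C> (filter (\<lambda>x. x \<in> Y) xs)" (is "good_sequencing Y \<C> ?ys")
proof (rule good_sequencingI)
  show "?ys \<in> permutations_of_set Y"
    using xs \<open>Y \<subseteq> X\<close> by (auto simp: good_sequencing_def permutations_of_set_def)
next
  fix i j k assume ijk: "i < j" "j < k" "k < length ?ys"
  obtain h where h: "\<And>i. i < length ?ys \<Longrightarrow> h i < length xs \<and> xs ! h i = ?ys ! i"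
    and mono: "\<And>i j. i < j \<Longrightarrow> j < length ?ys \<Longrightarrow> h i < h j"
    using subseq_imp_index_map[OF subseq_filter_left] by metis
  have len: "i < length ?ys" "j < length ?ys"
    using ijk by auto
  have "(xs ! h i, xs ! h j, xs ! h k) \<notin> \<B>"
    using mono[OF ijk(1) len(2)] mono[OF ijk(2,3)] h[OF ijk(3)]
    by (intro good_sequencingD[OF xs]) auto
  then show "(?ys ! i, ?ys ! j, ?ys ! k) \<notin> \<C>"
    using \<open>\<C> \<subseteq> \<B>\<close> h[OF len(1)] h[OF len(2)] h[OF ijk(3)] by auto
qed

text \<open>Read contrapositively: the absence of good sequencings survives relabelling.\<close>

lemma good_sequencing_inv_into:
  assumes f: "inj_on f X" and ys: "good_sequencing (f ` X) (map_triple f ` \<B>) ys"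
  shows "good_sequencing X \<B> (map (inv_into X f) ys)"
proof (rule good_sequencingI)
  have set: "set ys = f ` X" and dist: "distinct ys"
    using ys by (simp_all add: good_sequencing_def permutations_of_set_def)
  have "inj_on (inv_into X f) (set ys)"
    unfolding set by (rule inj_on_inv_into) simp
  then show "map (inv_into X f) ys \<in> permutations_of_set X"
    using dist set inv_into_image_cancel[OF f order_refl]
    by (simp add: permutations_of_set_def distinct_map)
  fix i j k assume ijk: "i < j" "j < k" "k < length (map (inv_into X f) ys)"
  let ?zs = "map (inv_into X f) ys"
  have inv: "f (?zs ! l) = ys ! l" if "l < length ys" for l
    using nth_mem[OF that] that unfolding set by (simp add: f_inv_into_f)
  show "(?zs ! i, ?zs ! j, ?zs ! k) \<notin> \<B>"
  proof
    assume B: "(?zs ! i, ?zs ! j, ?zs ! k) \<in> \<B>"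
    have "(ys ! i, ys ! j, ys ! k) = map_triple f (?zs ! i, ?zs ! j, ?zs ! k)"
      using ijk inv by (simp del: nth_map)
    then have "(ys ! i, ys ! j, ys ! k) \<in> map_triple f ` \<B>"
      using B by (rule image_eqI)
    then show False
      using good_sequencingD[OF ys] ijk by simp
  qed
qed

theorem theorem5p3:
  fixes v :: nat and X :: "'a set" and \<B> :: "'a set set" and B\<^sub>0 :: "'a set"
  assumes "is_PBD v L_DTS X \<B>"
    and "B\<^sub>0 \<in> \<B>"
    and "card B\<^sub>0 \<in> K_star_DTS"
  shows "v \<in> K_star_DTS"
proof -
  have X: "finite X" "card X = v"
    and blocks: "\<And>B. B \<in> \<B> \<Longrightarrow> B \<subseteq> X \<and> card B \<in> L_DTS"
    and pairs: "\<And>x y. x \<in> X \<Longrightarrow> y \<in> X \<Longrightarrow> x \<noteq> y \<Longrightarrow> \<exists>!B. B \<in> \<B> \<and> x \<in> B \<and> y \<in> B"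
    using assms(1) by (auto simp: is_PBD_def)
  obtain Y :: "nat set" and \<C> where Y: "is_DTS (card B\<^sub>0) Y \<C>"
    and not_good: "\<nexists>xs. good_sequencing Y \<C> xs" and "card B\<^sub>0 \<ge> 3"
    using assms(3) by (auto simp: K_star_DTS_def)
  have finB: "finite B" if "B \<in> \<B>" for B
    using blocks[OF that] X(1) finite_subset by blast
  have "finite Y" "card Y = card B\<^sub>0"
    using Y by (auto simp: is_DTS_def)
  then obtain f where "bij_betw f Y B\<^sub>0"
    using finite_same_card_bij[OF _ finB[OF assms(2)]] by blast
  then have f: "inj_on f Y" "f ` Y = B\<^sub>0"
    by (simp_all add: bij_betw_def)
  have "\<exists>\<D>. is_DTS (card B) B \<D>" if "B \<in> \<B>" for B
    using DTS_exists[of "card B"] blocks[OF that] finB[OF that] DTS_transfer by blast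
  then obtain E where E: "\<And>B. B \<in> \<B> \<Longrightarrow> is_DTS (card B) B (E B)"
    by metis
  \<comment> \<open>Any system will do on the other blocks; on \<open>B\<^sub>0\<close> the
    relabelled system without good sequencing is forced.\<close>
  define D where "D = E(B\<^sub>0 := map_triple f ` \<C>)"
  have D: "is_DTS (card B) B (D B)" if "B \<in> \<B>" for B
    using E[OF that] is_DTS_image[OF Y f(1)] f(2) by (auto simp: D_def)
  \<comment> \<open>The empty set plays the part of \<T> in \<open>DTS_decomposition\<close>: every
    pair lies in a block.\<close>
  define \<D> where "\<D> = {} \<union> (\<Union>B\<in>\<B>. D B)"
  have \<D>: "is_DTS v X \<D>"
    unfolding \<D>_def using X blocks D pairs by (intro DTS_decomposition) simp_all
  \<comment> \<open>\<open>K_star_DTS\<close> asks for natural numbers as points.\<close>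
  obtain g :: "'a \<Rightarrow> nat" where g: "inj_on g X"
    using finite_imp_inj_to_nat_seg[OF X(1)] by blast
  \<comment> \<open>A good sequencing is pulled back along \<open>g\<close> to \<open>X\<close>,
    restricted to \<open>B\<^sub>0\<close>, and pulled back along \<open>f\<close> to
    \<open>Y\<close>, where none exists.\<close>
  have "\<not> good_sequencing (g ` X) (map_triple g ` \<D>) xs" for xs
  proof
    assume "good_sequencing (g ` X) (map_triple g ` \<D>) xs"
    from good_sequencing_inv_into[OF g this]
    obtain ys where "good_sequencing X \<D> ys"
      by blast
    moreover have "map_triple f ` \<C> \<subseteq> \<D>"
      using assms(2) by (auto simp: \<D>_def D_def)
    ultimately obtain zs where "good_sequencing (f ` Y) (map_triple f ` \<C>) zs"
      using good_sequencing_restrict blocks[OF assms(2)] f(2) by metis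
    then show False
      using good_sequencing_inv_into[OF f(1)] not_good by blast
  qed
  moreover have "v \<ge> 3"
    using \<open>card B\<^sub>0 \<ge> 3\<close> card_mono[OF X(1), of B\<^sub>0] blocks[OF assms(2)] X(2) by simp
  ultimately show ?thesis
    unfolding K_star_DTS_def mem_Collect_eq using is_DTS_image[OF \<D> g] by metis
qed

end
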